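(* The sequential dynamical systems, together with the homomorphisms of sequential dynamical systems defined by Laubenbacher and Pareigis, form a full subcategory of the category $\mathbf{PSN}$ of probabilistic sequential networks and their morphisms.
   Context: Local functions. Let $\Gamma$ be a finite graph with vertex set $V_\Gamma=\{1,\dots,n\}$ and edge set $E_\Gamma\subseteq V_\Gamma\times V_\Gamma$, let $(k_a)_{a\in V_\Gamma}$ be finite sets and $k^n=k_1\times\cdots\times k_n$. A local function at the vertex $a$ is a map $f_a:k^n\to k^n$ of the form $f_a(x_1,\dots,x_n)=(x_1,\dots,x_{a-1},\overline f(x),x_{a+1},\dots,x_n)$, where $\overline f(x)\in k_a$ depends only on the variables connected to $a$ in $\Gamma$ ($x_a$ itself included). Sequential dynamical system (SDS). It is a triple $(\Gamma,(f_a:k^n\to k^n)_{a\in V_\Gamma},\alpha)$ consisting of one local function for each vertex and a permutation (schedule) $\alpha=(\alpha_1\ \ldots\ \alpha_n)$ of $V_\Gamma$; its update function is $f=f_{\alpha_1}\circ\cdots\circ f_{\alpha_n}$. Homomorphisms of SDS (Laubenbacher and Pareigis, in slightly different notation). Let $F=(\Gamma,(f_a:k^n\to k^n),\alpha)$ and $G=(\Delta,(g_b:k^m\to k^m),\beta)$ be SDS, where $\Delta$ has $m$ vertices, local state sets $k'_b$ and $k^m:=k'_1\times\cdots\times k'_m$. Let $\phi:\Delta\to\Gamma$ be a graph morphism (adjacent vertices may be sent to the same vertex) and let $\widehat\phi_b:k_{\phi(b)}\to k'_b$, $b\in V_\Delta$, be a family of maps; they induce the adjoint map $h_\phi:k^n\to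 k^m$, $h_\phi(x_1,\dots,x_n)=(\widehat\phi_1(x_{\phi(1)}),\dots,\widehat\phi_m(x_{\phi(m)}))$. Then $h:F\to G$ is a homomorphism of SDS if, for all sets of orders $\tau_\beta$ associated to $\beta$ in the connected components of $\Delta$ (a phrase which the source uses, following Laubenbacher and Pareigis, without defining it further), the map $h_\phi$ satisfies, for every $i$: $(g_{\beta_l}\circ g_{\beta_{l+1}}\circ\cdots\circ g_{\beta_s})\circ h_\phi=h_\phi\circ f_{\alpha_i}$, where $\{\beta_l,\beta_{l+1},\dots,\beta_s\}=\phi^{-1}(\alpha_i)$; and $\mathrm{id}_{k^m}\circ h_\phi=h_\phi\circ f_{\alpha_i}$ if $\phi^{-1}(\alpha_i)=\emptyset$. (Laubenbacher and Pareigis proved that these conditions imply $h_\phi\circ f_{\alpha_1}\circ\cdots\circ f_{\alpha_n}=g_{\beta_1}\circ\cdots\circ g_{\beta_m}\circ h_\phi$.) Probabilistic sequential network (PSN). It is a tuple $\mathcal D=(\Gamma,\{F_a\}_{a=1}^n,(k_a)_{a=1}^n,(\alpha^j)_j,C=\{c_1,\dots,c_s\})$ consisting of a finite graph $\Gamma$ with $n$ vertices; finite sets $k_a$; for each vertex $a$ a finite set $F_a$ of local functions at $a$; a finite family of permutations of $V_\Gamma$; and probabilities $c_i=p(f_i)\in[0,1]$, with $c_1+\cdots+c_s=1$, assigned to a set $S=\{f_1,\dots,f_s\}$ of selected update functions. Each update function is obtained by choosing one local function in each $F_a$ and one permutation $\alpha$ of the family and composing the chosen local functions in the order $f_{\alpha_1}\circ\cdots\circ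 f_{\alpha_n}$; thus each update function comes with an SDS $(\Gamma,(f_a),\alpha)$. An SDS is regarded as the particular PSN having exactly one local function for each vertex and exactly one permutation (so a single update function, with probability $1$). Morphisms of PSN. Let $\mathcal D_1$ be a PSN on $\Gamma$ ($n$ vertices, local state sets $k_a$, global states $k^n$, selected update functions $S_1$) and $\mathcal D_2$ a PSN on $\Delta$ ($m$ vertices, local state sets $k'_b$, global states $k^m$, selected update functions $S_2$). A morphism $h=(\phi,h_\phi):\mathcal D_1\to\mathcal D_2$ consists of: (1) a graph morphism $\phi:\Delta\to\Gamma$ and a family of maps $\widehat\phi_b:k_{\phi(b)}\to k'_b$, $b\in V_\Delta$, inducing the adjoint map $h_\phi:k^n\to k^m$ by the formula above; (2) for every $f\in S_1$, with SDS $(\Gamma,(f_a),\alpha)$, there is a selected $g\in S_2$, with SDS $(\Delta,(g_b),\beta)$, such that $h$ is a homomorphism of SDS from the first SDS to the second; that is, the commutation conditions above hold, together with the resulting identity $h_\phi\circ f_{\alpha_1}\circ\cdots\circ f_{\alpha_n}=g_{\beta_1}\circ\cdots\circ g_{\beta_m}\circ h_\phi$. The selection defines a map $\mu=\mu_h:S_1\to S_2$, $\mu(f)=g$. Composition and identities in $\mathbf{PSN}$. $(\phi_2,h_{\phi_2})\circ(\phi_1,h_{\phi_1})=(\phi_1\circ\phi_2,\,h_{\phi_2}\circ h_{\phi_1})$, with $\mu_{h_2\circ h_1}=\mu_{h_2}\circ\mu_{h_1}$; the identity of $\mathcal D$ is $\phi=\mathrm{id}_\Gamma$, $h_\phi=\mathrm{id}_{k^n}$,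 $\mu=\mathrm{id}_S$.
   Formalization: Homomorphisms of SDS (and so of PSN) are also required to have preimages φ⁻¹(α_1),…,φ⁻¹(α_n) that form, on each connected component of Δ, consecutive segments of β in the sequence of α; orders associated to β are those inducing the same order on each component. *)

theory Defs
  imports Complex_Main "HOL-Library.FuncSet" "HOL-Combinatorics.Multiset_Permutations"
begin

section \<open>Categories with hom-sets indexed by pairs of objects\<close>

text \<open>In \<open>Comp C A B D g f\<close> the arrows are \<open>f : A \<rightarrow> B\<close> and \<open>g : B \<rightarrow> D\<close>. Hom-sets of different
  pairs of objects need not be disjoint: source and target are always given explicitly.\<close>

record ('o, 'm) precategory =
  Ob :: "'o set"
  Hom :: "'o \<Rightarrow> 'o \<Rightarrow> 'm set"
  Ident :: "'o \<Rightarrow> 'm"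
  Comp :: "'o \<Rightarrow> 'o \<Rightarrow> 'o \<Rightarrow> 'm \<Rightarrow> 'm \<Rightarrow> 'm"

locale category =
  fixes C :: "('o, 'm) precategory"
  assumes Ident_in_Hom: "A \<in> Ob C \<Longrightarrow> Ident C A \<in> Hom C A A"
    and Comp_in_Hom: "\<lbrakk>A \<in> Ob C; B \<in> Ob C; D \<in> Ob C; f \<in> Hom C A B; g \<in> Hom C B D\<rbrakk>
      \<Longrightarrow> Comp C A B D g f \<in> Hom C A D"
    and Comp_Ident_right: "\<lbrakk>A \<in> Ob C; B \<in> Ob C; f \<in> Hom C A B\<rbrakk>
      \<Longrightarrow> Comp C A A B f (Ident C A) = f"
    and Comp_Ident_left: "\<lbrakk>A \<in> Ob C; B \<in> Ob C; f \<in> Hom C A B\<rbrakk>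
      \<Longrightarrow> Comp C A B B (Ident C B) f = f"
    and Comp_assoc: "\<lbrakk>A \<in> Ob C; B \<in> Ob C; D \<in> Ob C; E \<in> Ob C;
        f \<in> Hom C A B; g \<in> Hom C B D; h \<in> Hom C D E\<rbrakk>
      \<Longrightarrow> Comp C A D E h (Comp C A B D g f) = Comp C A B E (Comp C B D E h g) f"

definition full_subcategory_on :: "('o, 'm) precategory \<Rightarrow> 'o set \<Rightarrow> ('o, 'm) precategory" where
  "full_subcategory_on C P = C\<lparr>Ob := Ob C \<inter> P\<rparr>"

locale category_functor = source: category C + target: category D
  for C :: "('o, 'm) precategory" and D :: "('p, 'n) precategory" +
  fixes FOb :: "'o \<Rightarrow> 'p" and FHom :: "'o \<Rightarrow> 'o \<Rightarrow> 'm \<Rightarrow> 'n"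
  assumes FOb_in_Ob: "A \<in> Ob C \<Longrightarrow> FOb A \<in> Ob D"
    and FHom_in_Hom: "\<lbrakk>A \<in> Ob C; B \<in> Ob C; f \<in> Hom C A B\<rbrakk>
      \<Longrightarrow> FHom A B f \<in> Hom D (FOb A) (FOb B)"
    and FHom_Ident: "A \<in> Ob C \<Longrightarrow> FHom A A (Ident C A) = Ident D (FOb A)"
    and FHom_Comp: "\<lbrakk>A \<in> Ob C; B \<in> Ob C; E \<in> Ob C; f \<in> Hom C A B; g \<in> Hom C B E\<rbrakk>
      \<Longrightarrow> FHom A E (Comp C A B E g f)
          = Comp D (FOb A) (FOb B) (FOb E) (FHom B E g) (FHom A B f)"

locale category_isomorphism = category_functor C D FOb FHom
  for C :: "('o, 'm) precategory" and D :: "('p, 'n) precategory"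
    and FOb :: "'o \<Rightarrow> 'p" and FHom :: "'o \<Rightarrow> 'o \<Rightarrow> 'm \<Rightarrow> 'n" +
  assumes bij_on_Ob: "bij_betw FOb (Ob C) (Ob D)"
    and bij_on_Hom: "\<lbrakk>A \<in> Ob C; B \<in> Ob C\<rbrakk>
      \<Longrightarrow> bij_betw (FHom A B) (Hom C A B) (Hom D (FOb A) (FOb B))"


section \<open>Graphs with local states, local functions, update functions\<close>

text \<open>The local state sets are finite subsets of one type \<open>'s\<close>; a global state is an extensional
  function on the vertices, and a map between sets of global states is an extensional function, so
  that equality of maps is equality in HOL.\<close>

type_synonym 's state = "nat \<Rightarrow> 's"
type_synonym 's gmap = "'s state \<Rightarrow> 's state"

record 's network =
  nverts :: nat
  edges :: "(nat \<times> nat) set"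
  local_states :: "nat \<Rightarrow> 's set"

definition verts :: "('s, 'z) network_scheme \<Rightarrow> nat set" where
  "verts N = {1..nverts N}"

definition states :: "('s, 'z) network_scheme \<Rightarrow> 's state set" where
  "states N = (\<Pi>\<^sub>E a\<in>verts N. local_states N a)"

text \<open>Edges are read without orientation.\<close>

definition adjacent :: "('s, 'z) network_scheme \<Rightarrow> nat \<Rightarrow> nat \<Rightarrow> bool" where
  "adjacent N a b \<longleftrightarrow> (a, b) \<in> edges N \<or> (b, a) \<in> edges N"

definition components :: "('s, 'z) network_scheme \<Rightarrow> nat set set" where
  "components N = verts N // {(a, b). a \<in> verts N \<and> b \<in> verts N \<and> (adjacent N)\<^sup>*\<^sup>* a b}"

definition is_network :: "('s, 'z) network_scheme \<Rightarrow> bool" where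
  "is_network N \<longleftrightarrow> edges N \<subseteq> verts N \<times> verts N \<and> local_states N \<in> extensional (verts N)
     \<and> (\<forall>a\<in>verts N. finite (local_states N a))"

definition schedules :: "('s, 'z) network_scheme \<Rightarrow> nat list set" where
  "schedules N = permutations_of_set (verts N)"

definition local_functions :: "('s, 'z) network_scheme \<Rightarrow> nat \<Rightarrow> 's gmap set" where
  "local_functions N a = {f. \<exists>fbar \<in> states N \<rightarrow> local_states N a.
     (\<forall>x\<in>states N. \<forall>y\<in>states N.
        (\<forall>b\<in>verts N. b = a \<or> adjacent N a b \<longrightarrow> x b = y b) \<longrightarrow> fbar x = fbar y)
     \<and> f = (\<lambda>x\<in>states N. x(a := fbar x))}"

text \<open>The composite \<open>f\<^bsub>a1\<^esub> \<circ> \<dots> \<circ> f\<^bsub>ar\<^esub>\<close> over a list \<open>[a1, \<dots>, ar]\<close> of vertices (the last one is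
  applied first); it is the identity of the set of states if the list is empty.\<close>

definition composite :: "('s, 'z) network_scheme \<Rightarrow> (nat \<Rightarrow> 's gmap) \<Rightarrow> nat list \<Rightarrow> 's gmap" where
  "composite N f as = foldr (\<lambda>a. compose (states N) (f a)) as (\<lambda>x\<in>states N. x)"


section \<open>Sequential dynamical systems\<close>

record 's sds = "'s network" +
  loc_fun :: "nat \<Rightarrow> 's gmap"
  schedule :: "nat list"

definition is_sds :: "'s sds \<Rightarrow> bool" where
  "is_sds F \<longleftrightarrow> is_network F \<and> loc_fun F \<in> (\<Pi>\<^sub>E a\<in>verts F. local_functions F a)
     \<and> schedule F \<in> schedules F"

definition update :: "'s sds \<Rightarrow> 's gmap" where
  "update F = composite F (loc_fun F) (schedule F)"

definition graph_morphisms ::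
    "('s, 'y) network_scheme \<Rightarrow> ('s, 'z) network_scheme \<Rightarrow> (nat \<Rightarrow> nat) set" where
  "graph_morphisms M N = {\<phi> \<in> verts M \<rightarrow>\<^sub>E verts N.
     \<forall>b\<in>verts M. \<forall>b'\<in>verts M. adjacent M b b' \<longrightarrow> \<phi> b = \<phi> b' \<or> adjacent N (\<phi> b) (\<phi> b')}"

text \<open>A morphism from \<open>N\<close> to \<open>M\<close> goes against the direction of its graph morphism.\<close>

definition adjoint_map :: "('s, 'y) network_scheme \<Rightarrow> ('s, 'z) network_scheme \<Rightarrow>
    (nat \<Rightarrow> nat) \<Rightarrow> (nat \<Rightarrow> 's \<Rightarrow> 's) \<Rightarrow> 's gmap" where
  "adjoint_map N M \<phi> \<phi>hat = (\<lambda>x\<in>states N. \<lambda>b\<in>verts M. \<phi>hat b (x (\<phi> b)))"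

definition morphism_data :: "('s, 'y) network_scheme \<Rightarrow> ('s, 'z) network_scheme \<Rightarrow>
    ((nat \<Rightarrow> nat) \<times> 's gmap) set" where
  "morphism_data N M = {(\<phi>, h). \<phi> \<in> graph_morphisms M N
     \<and> (\<exists>\<phi>hat. (\<forall>b\<in>verts M. \<phi>hat b \<in> local_states N (\<phi> b) \<rightarrow> local_states M b)
            \<and> h = adjoint_map N M \<phi> \<phi>hat)}"

text \<open>A schedule \<open>\<beta>\<close> induces an order on every connected component of the graph. The vertex orders
  associated to \<open>\<beta>\<close> are the ones inducing the same orders on the components: the relative position
  of vertices in different components is immaterial, since their local functions commute.\<close>

definition associated_orders :: "('s, 'z) network_scheme \<Rightarrow> nat list \<Rightarrow> nat list set" where
  "associated_orders N \<beta> = {\<tau> \<in> schedules N.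
     \<forall>K\<in>components N. filter (\<lambda>b. b \<in> K) \<tau> = filter (\<lambda>b. b \<in> K) \<beta>}"

text \<open>The first condition is what makes the preimages \<open>\<phi>\<^sup>-\<^sup>1(\<alpha>\<^sub>i)\<close> segments
  \<open>{\<beta>\<^sub>l, \<beta>\<^bsub>l+1\<^esub>, \<dots>, \<beta>\<^sub>s}\<close> of the order: on each connected component the order is the concatenation of
  the segments lying over \<open>\<alpha>\<^sub>1, \<dots>, \<alpha>\<^sub>n\<close>, in this sequence. Without it the second condition would
  neither imply \<open>h \<circ> update F = update G \<circ> h\<close> nor be stable under composition. If \<open>\<phi>\<^sup>-\<^sup>1(a)\<close> is empty,
  the second condition reads \<open>id \<circ> h = h \<circ> f\<^sub>a\<close>.\<close>

definition sds_homs :: "'s sds \<Rightarrow> 's sds \<Rightarrow> ((nat \<Rightarrow> nat) \<times> 's gmap) set" where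
  "sds_homs F G = {(\<phi>, h) \<in> morphism_data F G. \<forall>\<tau>\<in>associated_orders G (schedule G).
     (\<forall>K\<in>components G. filter (\<lambda>b. b \<in> K) \<tau>
        = concat (map (\<lambda>a. filter (\<lambda>b. b \<in> K \<and> \<phi> b = a) \<tau>) (schedule F)))
     \<and> (\<forall>a\<in>verts F.
          compose (states F) (composite G (loc_fun G) (filter (\<lambda>b. \<phi> b = a) \<tau>)) h
          = compose (states F) h (loc_fun F a))}"

definition SDS :: "('s sds, (nat \<Rightarrow> nat) \<times> 's gmap) precategory" where
  "SDS = \<lparr>Ob = {F. is_sds F},
    Hom = sds_homs,
    Ident = (\<lambda>F. (\<lambda>a\<in>verts F. a, \<lambda>x\<in>states F. x)),
    Comp = (\<lambda>F G H (\<phi>2, h2) (\<phi>1, h1).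
      (compose (verts H) \<phi>1 \<phi>2, compose (states F) h2 h1))\<rparr>"


section \<open>Probabilistic sequential networks\<close>

text \<open>\<open>selected\<close> is the set \<open>S\<close> of selected update functions; \<open>choice f\<close> consists of the local
  functions and of the schedule which define \<open>f \<in> S\<close>; \<open>prob f\<close> is the probability of \<open>f\<close>.\<close>

record 's psn = "'s network" +
  loc_funs :: "nat \<Rightarrow> 's gmap set"
  schedule_family :: "nat list list"
  selected :: "'s gmap set"
  choice :: "'s gmap \<Rightarrow> (nat \<Rightarrow> 's gmap) \<times> nat list"
  prob :: "'s gmap \<Rightarrow> real"

definition sds_of :: "'s psn \<Rightarrow> 's gmap \<Rightarrow> 's sds" where
  "sds_of D f = \<lparr>nverts = nverts D, edges = edges D, local_states = local_states D,
     loc_fun = fst (choice D f), schedule = snd (choice D f)\<rparr>"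

definition is_psn :: "'s psn \<Rightarrow> bool" where
  "is_psn D \<longleftrightarrow> is_network D
     \<and> loc_funs D \<in> extensional (verts D)
     \<and> (\<forall>a\<in>verts D. finite (loc_funs D a) \<and> loc_funs D a \<subseteq> local_functions D a)
     \<and> set (schedule_family D) \<subseteq> schedules D
     \<and> finite (selected D)
     \<and> choice D \<in> selected D \<rightarrow>\<^sub>E (\<Pi>\<^sub>E a\<in>verts D. loc_funs D a) \<times> set (schedule_family D)
     \<and> (\<forall>f\<in>selected D. update (sds_of D f) = f)
     \<and> prob D \<in> selected D \<rightarrow>\<^sub>E {0..1}
     \<and> (\<Sum>f\<in>selected D. prob D f) = 1"

type_synonym 's psn_mor = "(nat \<Rightarrow> nat) \<times> 's gmap \<times> ('s gmap \<Rightarrow> 's gmap)"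

definition psn_homs :: "'s psn \<Rightarrow> 's psn \<Rightarrow> 's psn_mor set" where
  "psn_homs D1 D2 = {(\<phi>, h, \<mu>). (\<phi>, h) \<in> morphism_data D1 D2
     \<and> \<mu> \<in> selected D1 \<rightarrow>\<^sub>E selected D2
     \<and> (\<forall>f\<in>selected D1. (\<phi>, h) \<in> sds_homs (sds_of D1 f) (sds_of D2 (\<mu> f))
          \<and> compose (states D1) h f = compose (states D1) (\<mu> f) h)}"

definition PSN :: "('s psn, 's psn_mor) precategory" where
  "PSN = \<lparr>Ob = {D. is_psn D},
    Hom = psn_homs,
    Ident = (\<lambda>D. (\<lambda>a\<in>verts D. a, \<lambda>x\<in>states D. x, \<lambda>f\<in>selected D. f)),
    Comp = (\<lambda>D1 D2 D3 (\<phi>2, h2, \<mu>2) (\<phi>1, h1, \<mu>1).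
      (compose (verts D3) \<phi>1 \<phi>2, compose (states D1) h2 h1, compose (selected D1) \<mu>2 \<mu>1))\<rparr>"


section \<open>Sequential dynamical systems as probabilistic sequential networks\<close>

definition psn_of_sds :: "'s sds \<Rightarrow> 's psn" where
  "psn_of_sds F = \<lparr>nverts = nverts F, edges = edges F, local_states = local_states F,
     loc_funs = (\<lambda>a\<in>verts F. {loc_fun F a}), schedule_family = [schedule F],
     selected = {update F}, choice = (\<lambda>f\<in>{update F}. (loc_fun F, schedule F)),
     prob = (\<lambda>f\<in>{update F}. 1)\<rparr>"

definition psn_hom_of_sds_hom ::
    "'s sds \<Rightarrow> 's sds \<Rightarrow> (nat \<Rightarrow> nat) \<times> 's gmap \<Rightarrow> 's psn_mor" where
  "psn_hom_of_sds_hom F G = (\<lambda>(\<phi>, h). (\<phi>, h, \<lambda>f\<in>{update F}. update G))"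

definition deterministic_psns :: "'s psn set" where
  "deterministic_psns = {D. is_psn D \<and> (\<forall>a\<in>verts D. card (loc_funs D a) = 1)
     \<and> length (schedule_family D) = 1}"

end

theory Submission
  imports Defs
begin

text \<open>The unit and associativity laws are those of extensional functions, applied to each component
  of a morphism. Three points carry mathematical content.

  First, local functions at distinct non-adjacent vertices commute (\<open>local_functions_commute\<close>).
  Hence a composite of local functions depends only on the order which its list of vertices induces
  on each connected component (\<open>composite_eq_if_same_orders_on_components\<close>): the
  first vertex of one list can be moved to the front of the other one past vertices lying in other components.

  Second, if \<open>h\<close> intertwines each \<open>f\<^sub>a\<close> with the composite over the fibre \<open>\<phi>\<^sup>-\<^sup>1(a)\<close>, then it
  intertwines the composite over a list of vertices with the composite over the concatenation of
  their fibres (\<open>composite_intertwined\<close>). For a homomorphism of SDS this concatenation induces the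
  right orders on the components. Applied to the schedule this yields
  \<open>h \<circ> update F = update G \<circ> h\<close> (\<open>sds_hom_intertwines_update\<close>), so that a homomorphism of SDS is a
  morphism of PSN. Applied, for the second of two homomorphisms, to the fibres of the graph morphism
  of the first one, it yields closure under composition (\<open>sds_homs_Comp\<close>); this also uses that
  graph morphisms map components into components and that, within a component, fibres of a composite are concatenations of fibres
  (\<open>fibre_of_composite\<close>).

  Third, in a PSN with one local function for each vertex and one permutation, the choice of local
  functions is forced, so there is at most one selected update function; there is at least one
  because the probabilities add up to 1. Hence such PSN are exactly the images of SDS, and the map
  \<open>\<mu>\<close> of a morphism between them is determined, which gives fullness and faithfulness.\<close>


section \<open>Connected components\<close>

lemma equiv_connected:
  "equiv (verts N) {(a, b). a \<in> verts N \<and> b \<in> verts N \<and> (adjacent N)\<^sup>*\<^sup>* a b}"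
proof -
  have "symp (adjacent N)" unfolding symp_def adjacent_def by auto
  then have "symp (adjacent N)\<^sup>*\<^sup>*" by (rule symp_rtranclp)
  then show ?thesis
    by (intro equivI) (auto intro!: refl_onI symI transI dest: sympD intro: rtranclp_trans)
qed

lemma components_subset_verts: "K \<in> components N \<Longrightarrow> K \<subseteq> verts N"
  unfolding components_def quotient_def by auto

lemma component_exists: "a \<in> verts N \<Longrightarrow> \<exists>K\<in>components N. a \<in> K"
  unfolding components_def quotient_def by auto

lemma component_closed_adjacent:
  assumes "K \<in> components N" "a \<in> K" "b \<in> verts N" "adjacent N a b"
  shows "b \<in> K"
  using assms unfolding components_def quotient_def
  by (auto intro: rtranclp.rtrancl_into_rtrancl)

lemma graph_morphism_maps_component:
  assumes M: "is_network M" and \<phi>: "\<phi> \<in> graph_morphisms M N" and L: "L \<in> components M"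
  shows "\<exists>K\<in>components N. \<phi> ` L \<subseteq> K"
proof -
  obtain a where a: "a \<in> verts M"
    and L_eq: "L = {b. b \<in> verts M \<and> (adjacent M)\<^sup>*\<^sup>* a b}"
    using L unfolding components_def quotient_def by auto
  have maps: "\<phi> b \<in> verts N" if "b \<in> verts M" for b
    using \<phi> that unfolding graph_morphisms_def by auto
  obtain K where K: "K \<in> components N" "\<phi> a \<in> K"
    using component_exists maps a by blast
  have "b \<in> verts M \<and> \<phi> b \<in> K" if "(adjacent M)\<^sup>*\<^sup>* a b" for b
    using that
  proof (induction rule: rtranclp_induct)
    case base
    then show ?case using K a by simp
  next
    case (step b c)
    have c: "c \<in> verts M"
      using M step.hyps(2) unfolding is_network_def adjacent_def by auto
    then have "\<phi> b = \<phi> c \<or> adjacent N (\<phi> b) (\<phi> c)"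
      using \<phi> step unfolding graph_morphisms_def by auto
    then show ?case
      using step.IH c component_closed_adjacent[OF K(1)] maps by metis
  qed
  then show ?thesis using K L_eq by auto
qed


section \<open>Local functions and their composites\<close>

lemma local_function_PiE:
  assumes "f \<in> local_functions N a" "a \<in> verts N"
  shows "f \<in> states N \<rightarrow>\<^sub>E states N"
proof -
  obtain fbar where fbar: "fbar \<in> states N \<rightarrow> local_states N a"
    and f: "f = (\<lambda>x\<in>states N. x(a := fbar x))"
    using assms(1) unfolding local_functions_def by auto
  have "x(a := fbar x) \<in> states N" if "x \<in> states N" for x
    using that fbar assms(2) unfolding states_def
    by (auto simp: PiE_iff Pi_iff extensional_def)
  then show ?thesis unfolding f by auto
qed

lemma local_functions_commute:
  assumes f: "f \<in> local_functions N a" and g: "g \<in> local_functions N b"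
    and verts: "a \<in> verts N" "b \<in> verts N" and "a \<noteq> b" and nonadj: "\<not> adjacent N a b"
  shows "compose (states N) f g = compose (states N) g f"
proof -
  obtain fbar where fbar: "\<forall>x\<in>states N. \<forall>y\<in>states N.
        (\<forall>b\<in>verts N. b = a \<or> adjacent N a b \<longrightarrow> x b = y b) \<longrightarrow> fbar x = fbar y"
      and f_eq: "f = (\<lambda>x\<in>states N. x(a := fbar x))"
    using f unfolding local_functions_def by auto
  obtain gbar where gbar: "\<forall>x\<in>states N. \<forall>y\<in>states N.
        (\<forall>c\<in>verts N. c = b \<or> adjacent N b c \<longrightarrow> x c = y c) \<longrightarrow> gbar x = gbar y"
      and g_eq: "g = (\<lambda>x\<in>states N. x(b := gbar x))"
    using g unfolding local_functions_def by auto
  have nonadj': "\<not> adjacent N b a" using nonadj unfolding adjacent_def by auto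
  show ?thesis
  proof (rule extensionalityI)
    fix x assume x: "x \<in> states N"
    have fx: "f x = x(a := fbar x)" "f x \<in> states N"
      and gx: "g x = x(b := gbar x)" "g x \<in> states N"
      using x f_eq g_eq local_function_PiE[OF f verts(1)] local_function_PiE[OF g verts(2)] by auto
    have "fbar (g x) = fbar x"
      by (rule fbar[rule_format, OF gx(2) x]) (use gx(1) \<open>a \<noteq> b\<close> nonadj in auto)
    moreover have "gbar (f x) = gbar x"
      by (rule gbar[rule_format, OF fx(2) x]) (use fx(1) \<open>a \<noteq> b\<close> nonadj' in auto)
    moreover have "f (g x) = (g x)(a := fbar (g x))" "g (f x) = (f x)(b := gbar (f x))"
      using fx(2) gx(2) f_eq g_eq by auto
    ultimately show "compose (states N) f g x = compose (states N) g f x"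
      using x fx(1) gx(1) \<open>a \<noteq> b\<close> by (simp add: compose_def fun_upd_twist)
  qed auto
qed

lemma compose_PiE: "\<lbrakk>f \<in> A \<rightarrow>\<^sub>E B; g \<in> B \<rightarrow>\<^sub>E C\<rbrakk> \<Longrightarrow> compose A g f \<in> A \<rightarrow>\<^sub>E C"
  by (auto simp: compose_def)

lemma compose_restrict_id:
  assumes "f \<in> A \<rightarrow>\<^sub>E B"
  shows "compose A f (\<lambda>x\<in>A. x) = f" "compose A (\<lambda>x\<in>B. x) f = f"
  using assms by (auto simp: compose_def PiE_iff fun_eq_iff extensional_def)

lemma composite_Nil: "composite N f [] = (\<lambda>x\<in>states N. x)"
  unfolding composite_def by simp

lemma composite_Cons: "composite N f (a # as) = compose (states N) (f a) (composite N f as)"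
  unfolding composite_def by simp

lemma composite_PiE:
  assumes f: "f \<in> (\<Pi>\<^sub>E a\<in>verts N. local_functions N a)" and "set as \<subseteq> verts N"
  shows "composite N f as \<in> states N \<rightarrow>\<^sub>E states N"
  using assms(2)
proof (induction as)
  case Nil
  then show ?case by (auto simp: composite_Nil)
next
  case (Cons a as)
  then have "a \<in> verts N" and "composite N f as \<in> states N \<rightarrow>\<^sub>E states N" by simp_all
  moreover from this have "f a \<in> states N \<rightarrow>\<^sub>E states N"
    using local_function_PiE[OF PiE_mem[OF f]] by simp
  ultimately show ?case
    unfolding composite_Cons by (intro compose_PiE)
qed

lemma composite_singleton:
  assumes "f \<in> (\<Pi>\<^sub>E a\<in>verts N. local_functions N a)" "a \<in> verts N"
  shows "composite N f [a] = f a"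
proof -
  have "f a \<in> states N \<rightarrow>\<^sub>E states N"
    using local_function_PiE[OF PiE_mem[OF assms]] assms(2) .
  then show ?thesis
    unfolding composite_Cons composite_Nil by (rule compose_restrict_id)
qed

lemma composite_append:
  assumes f: "f \<in> (\<Pi>\<^sub>E a\<in>verts N. local_functions N a)"
    and "set as \<subseteq> verts N" and bs: "set bs \<subseteq> verts N"
  shows "composite N f (as @ bs) = compose (states N) (composite N f as) (composite N f bs)"
  using assms(2)
proof (induction as)
  case Nil
  show ?case
    using compose_restrict_id(2)[OF composite_PiE[OF f bs]] by (simp only: composite_Nil append_Nil)
next
  case (Cons a as)
  then show ?case
    using compose_assoc[of "composite N f bs" "states N" "states N" "f a" "composite N f as"]
      composite_PiE[OF f bs]
    by (auto simp: composite_Cons)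
qed

lemma composite_move_to_front:
  assumes f: "f \<in> (\<Pi>\<^sub>E a\<in>verts N. local_functions N a)"
    and a: "a \<in> verts N" and as: "set as \<subseteq> verts N" and bs: "set bs \<subseteq> verts N"
    and indep: "\<forall>b\<in>set as. b \<noteq> a \<and> \<not> adjacent N a b"
  shows "composite N f (as @ a # bs) = composite N f (a # as @ bs)"
  using as indep
proof (induction as)
  case Nil
  then show ?case by simp
next
  case (Cons c as)
  then have c: "c \<in> verts N" "c \<noteq> a" "\<not> adjacent N a c" by auto
  let ?S = "states N" and ?r = "composite N f (as @ bs)"
  have r: "?r \<in> ?S \<rightarrow> ?S"
    using composite_PiE[OF f, of "as @ bs"] Cons.prems bs by auto
  have "f a \<in> local_functions N a" "f c \<in> local_functions N c"
    using PiE_mem[OF f] a c(1) by auto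
  then have comm: "compose ?S (f c) (f a) = compose ?S (f a) (f c)"
    using local_functions_commute[of "f a" N a "f c" c] a c by simp
  have "composite N f ((c # as) @ a # bs) = compose ?S (f c) (compose ?S (f a) ?r)"
    using Cons by (simp add: composite_Cons)
  also have "\<dots> = compose ?S (f a) (compose ?S (f c) ?r)"
    using compose_assoc[OF r, of "f c" "f a"] compose_assoc[OF r, of "f a" "f c"] comm by simp
  finally show ?case by (simp add: composite_Cons)
qed

text \<open>Moving the first vertex of \<open>xs\<close> to the front of \<open>ys\<close> is possible because the vertices before
  its first occurrence in \<open>ys\<close> lie in other components.\<close>

lemma composite_eq_if_same_orders_on_components:
  assumes f: "f \<in> (\<Pi>\<^sub>E a\<in>verts N. local_functions N a)"
    and "set xs \<subseteq> verts N" "set ys \<subseteq> verts N"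
    and "\<forall>K\<in>components N. filter (\<lambda>b. b \<in> K) xs = filter (\<lambda>b. b \<in> K) ys"
  shows "composite N f xs = composite N f ys"
  using assms(2-)
proof (induction xs arbitrary: ys)
  case Nil
  have "ys = []"
  proof (rule ccontr)
    assume "ys \<noteq> []"
    then obtain b where b: "b \<in> set ys" by (cases ys) auto
    then obtain K where "K \<in> components N" "b \<in> K"
      using component_exists Nil.prems(2) by blast
    then show False using Nil.prems(3) b by (auto simp: filter_empty_conv dest!: sym[of "[]"])
  qed
  then show ?case by simp
next
  case (Cons x xs)
  then have x: "x \<in> verts N" by simp
  then obtain K where K: "K \<in> components N" "x \<in> K" using component_exists by blast
  have "x # filter (\<lambda>b. b \<in> K) xs = filter (\<lambda>b. b \<in> K) ys"
    using Cons.prems(3) K by auto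
  then obtain us vs where ys: "ys = us @ x # vs" and us: "\<forall>u\<in>set us. u \<notin> K"
    and vs: "filter (\<lambda>b. b \<in> K) xs = filter (\<lambda>b. b \<in> K) vs"
    unfolding Cons_eq_filter_iff by blast
  have sub: "set us \<subseteq> verts N" "set vs \<subseteq> verts N" using Cons.prems(2) ys by auto
  have "\<forall>b\<in>set us. b \<noteq> x \<and> \<not> adjacent N x b"
    using us K component_closed_adjacent sub(1) by blast
  then have "composite N f ys = composite N f (x # us @ vs)"
    unfolding ys using composite_move_to_front[OF f x] sub by blast
  moreover have "composite N f xs = composite N f (us @ vs)"
  proof (rule Cons.IH)
    show "\<forall>K'\<in>components N. filter (\<lambda>b. b \<in> K') xs = filter (\<lambda>b. b \<in> K') (us @ vs)"
    proof
      fix K' assume K': "K' \<in> components N"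
      have eq: "filter (\<lambda>b. b \<in> K') (x # xs) = filter (\<lambda>b. b \<in> K') (us @ x # vs)"
        using Cons.prems(3) K' ys by blast
      show "filter (\<lambda>b. b \<in> K') xs = filter (\<lambda>b. b \<in> K') (us @ vs)"
      proof (cases "x \<in> K'")
        case True
        have "\<forall>u\<in>set us. u \<notin> K'"
        proof (rule ccontr)
          assume "\<not> ?thesis"
          moreover have "K' = K"
          proof -
            show ?thesis
              using quotient_disj[OF equiv_connected] K K' True unfolding components_def by blast
          qed
          ultimately show False using us by blast
        qed
        \<comment> \<open>Hence the displayed \<open>x\<close> is the head of both filtered lists and can be cancelled.\<close>
        then have "filter (\<lambda>b. b \<in> K') us = []" by simp
        then show ?thesis using eq True by simp
      next
        case False
        then show ?thesis using eq by simp
      qed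
    qed
  qed (use Cons.prems sub in auto)
  ultimately show ?case by (simp add: composite_Cons)
qed


section \<open>Intertwining maps and fibres\<close>

lemma composite_intertwined:
  assumes f: "f \<in> (\<Pi>\<^sub>E a\<in>verts N. local_functions N a)"
    and g: "g \<in> (\<Pi>\<^sub>E b\<in>verts M. local_functions M b)"
    and h: "h \<in> states N \<rightarrow>\<^sub>E states M" and \<tau>: "set \<tau> \<subseteq> verts M"
    and comm: "\<forall>a\<in>verts N. compose (states N) (composite M g (filter (\<lambda>b. \<phi> b = a) \<tau>)) h
          = compose (states N) h (f a)"
    and "set as \<subseteq> verts N"
  shows "compose (states N) (composite M g (concat (map (\<lambda>a. filter (\<lambda>b. \<phi> b = a) \<tau>) as))) h
          = compose (states N) h (composite N f as)"
  using assms(6)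
proof (induction as)
  case Nil
  show ?case
    using compose_restrict_id[OF h] by (simp only: composite_Nil list.map concat.simps)
next
  case (Cons a as)
  let ?S = "states N"
  let ?fib = "\<lambda>a. filter (\<lambda>b. \<phi> b = a) \<tau>"
  let ?c = "composite M g (concat (map ?fib as))" and ?d = "composite M g (?fib a)"
  have sub: "set (?fib a) \<subseteq> verts M" "set (concat (map ?fib as)) \<subseteq> verts M"
    using \<tau> by auto
  have fa: "composite N f as \<in> ?S \<rightarrow> ?S"
    using composite_PiE[OF f] Cons.prems by (auto simp: PiE_iff)
  have h': "h \<in> ?S \<rightarrow> states M" using h by auto
  have "compose ?S (composite M g (concat (map ?fib (a # as)))) h
      = compose ?S (compose (states M) ?d ?c) h"
    using composite_append[OF g sub] by simp
  also have "\<dots> = compose ?S ?d (compose ?S ?c h)"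
    using compose_assoc[OF h'] by metis
  also have "\<dots> = compose ?S ?d (compose ?S h (composite N f as))"
    using Cons by simp
  also have "\<dots> = compose ?S (compose ?S ?d h) (composite N f as)"
    using compose_assoc[OF fa] by metis
  also have "\<dots> = compose ?S (compose ?S h (f a)) (composite N f as)"
    using comm Cons.prems by auto
  also have "\<dots> = compose ?S h (composite N f (a # as))"
    using compose_assoc[OF fa] by (metis composite_Cons)
  finally show ?case .
qed

text \<open>If the part of a list satisfying \<open>P\<close> is the concatenation of its fibres under \<open>\<psi>\<close> over \<open>ts\<close>,
  then each fibre under \<open>\<phi> \<circ> \<psi>\<close> is the concatenation of the fibres under \<open>\<psi>\<close> over the fibre of
  \<open>\<phi>\<close> in \<open>ts\<close>. The predicate \<open>P\<close> will be membership in a component.\<close>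

lemma fibre_of_composite:
  assumes "filter P xs = concat (map (\<lambda>c. filter (\<lambda>b. P b \<and> \<psi> b = c) xs) ts)"
  shows "filter (\<lambda>b. P b \<and> \<phi> (\<psi> b) = a) xs
    = concat (map (\<lambda>c. filter (\<lambda>b. P b \<and> \<psi> b = c) xs) (filter (\<lambda>c. \<phi> c = a) ts))"
proof -
  have restrict: "filter (\<lambda>b. \<phi> (\<psi> b) = a) (concat (map (\<lambda>c. filter (\<lambda>b. P b \<and> \<psi> b = c) xs) cs))
      = concat (map (\<lambda>c. filter (\<lambda>b. P b \<and> \<psi> b = c) xs) (filter (\<lambda>c. \<phi> c = a) cs))" for cs
  proof (induction cs)
    case (Cons c cs)
    have "filter (\<lambda>b. \<phi> (\<psi> b) = a) (filter (\<lambda>b. P b \<and> \<psi> b = c) xs)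
        = (if \<phi> c = a then filter (\<lambda>b. P b \<and> \<psi> b = c) xs else [])"
      by (auto simp: filter_empty_conv intro!: filter_cong)
    then show ?case using Cons by simp
  qed simp
  have "filter (\<lambda>b. P b \<and> \<phi> (\<psi> b) = a) xs = filter (\<lambda>b. \<phi> (\<psi> b) = a) (filter P xs)"
    by simp
  also have "\<dots> = filter (\<lambda>b. \<phi> (\<psi> b) = a)
      (concat (map (\<lambda>c. filter (\<lambda>b. P b \<and> \<psi> b = c) xs) ts))"
    by (rule arg_cong[OF assms])
  finally show ?thesis unfolding restrict .
qed

lemma filter_concat_fibres:
  "filter P (concat (map (\<lambda>a. filter (\<lambda>b. \<phi> b = a) xs) as))
    = concat (map (\<lambda>a. filter (\<lambda>b. P b \<and> \<phi> b = a) xs) as)"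
  by (induction as) (simp_all add: conj_commute)

lemma concat_map_concat_map:
  "concat (map G (concat (map F as))) = concat (map (\<lambda>a. concat (map G (F a))) as)"
  by (induction as) simp_all

lemma concat_map_filter_irrelevant:
  assumes "\<And>c. c \<notin> K \<Longrightarrow> G c = []"
  shows "concat (map G (filter (\<lambda>c. c \<in> K \<and> P c) ts)) = concat (map G (filter P ts))"
  using assms by (induction ts) auto


section \<open>Homomorphisms of sequential dynamical systems\<close>

lemma adjoint_map_PiE:
  assumes "\<phi> \<in> verts M \<rightarrow> verts N"
    and "\<forall>b\<in>verts M. \<phi>hat b \<in> local_states N (\<phi> b) \<rightarrow> local_states M b"
  shows "adjoint_map N M \<phi> \<phi>hat \<in> states N \<rightarrow>\<^sub>E states M"
proof -
  have "(\<lambda>b\<in>verts M. \<phi>hat b (x (\<phi> b))) \<in> states M" if "x \<in> states N" for x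
  proof -
    have "\<phi>hat b (x (\<phi> b)) \<in> local_states M b" if b: "b \<in> verts M" for b
    proof -
      have "x (\<phi> b) \<in> local_states N (\<phi> b)"
        using \<open>x \<in> states N\<close> funcset_mem[OF assms(1) b] unfolding states_def by (rule PiE_mem)
      then show ?thesis using assms(2) b by (blast dest: funcset_mem)
    qed
    then show ?thesis unfolding states_def by simp
  qed
  then show ?thesis unfolding adjoint_map_def by simp
qed

lemma morphism_dataD:
  assumes "(\<phi>, h) \<in> morphism_data N M"
  shows "\<phi> \<in> graph_morphisms M N" "\<phi> \<in> verts M \<rightarrow>\<^sub>E verts N" "h \<in> states N \<rightarrow>\<^sub>E states M"
proof -
  show \<phi>: "\<phi> \<in> graph_morphisms M N" and \<phi>': "\<phi> \<in> verts M \<rightarrow>\<^sub>E verts N"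
    using assms unfolding morphism_data_def graph_morphisms_def by auto
  show "h \<in> states N \<rightarrow>\<^sub>E states M"
    using assms adjoint_map_PiE[of \<phi> M N] \<phi>' unfolding morphism_data_def by auto
qed

lemma morphism_data_Ident:
  "(\<lambda>a\<in>verts N. a, \<lambda>x\<in>states N. x) \<in> morphism_data N N"
proof -
  have "(\<lambda>b\<in>verts N. x ((\<lambda>a\<in>verts N. a) b)) = x" if "x \<in> states N" for x
  proof -
    have "(\<lambda>b\<in>verts N. x ((\<lambda>a\<in>verts N. a) b)) = restrict x (verts N)"
      by (intro restrict_ext) simp
    also have "\<dots> = x"
      using that unfolding states_def by (rule PiE_restrict)
    finally show ?thesis .
  qed
  then have "(\<lambda>x\<in>states N. x) = adjoint_map N N (\<lambda>a\<in>verts N. a) (\<lambda>_ s. s)"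
    unfolding adjoint_map_def by (intro restrict_ext) (rule sym)
  moreover have "(\<lambda>a\<in>verts N. a) \<in> graph_morphisms N N"
    unfolding graph_morphisms_def by simp
  moreover have "\<forall>b\<in>verts N. (\<lambda>s. s) \<in> local_states N ((\<lambda>a\<in>verts N. a) b) \<rightarrow> local_states N b"
    by simp
  ultimately show ?thesis
    unfolding morphism_data_def by (intro CollectI case_prodI conjI exI[of _ "\<lambda>_ s. s"])
qed

lemma morphism_data_Comp:
  assumes 1: "(\<phi>1, h1) \<in> morphism_data N M" and 2: "(\<phi>2, h2) \<in> morphism_data M L"
  shows "(compose (verts L) \<phi>1 \<phi>2, compose (states N) h2 h1) \<in> morphism_data N L"
proof -
  let ?\<phi> = "compose (verts L) \<phi>1 \<phi>2"
  obtain p1 where p1: "\<forall>b\<in>verts M. p1 b \<in> local_states N (\<phi>1 b) \<rightarrow> local_states M b"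
    and h1: "h1 = adjoint_map N M \<phi>1 p1"
    using 1 unfolding morphism_data_def by auto
  obtain p2 where p2: "\<forall>b\<in>verts L. p2 b \<in> local_states M (\<phi>2 b) \<rightarrow> local_states L b"
    and h2: "h2 = adjoint_map M L \<phi>2 p2"
    using 2 unfolding morphism_data_def by auto
  let ?p = "\<lambda>b. p2 b \<circ> p1 (\<phi>2 b)"
  note D1 = morphism_dataD[OF 1] and D2 = morphism_dataD[OF 2]
  have \<phi>2: "\<phi>2 b \<in> verts M" if "b \<in> verts L" for b using D2(2) that by auto
  have "?\<phi> \<in> graph_morphisms L N"
  proof -
    have "\<phi>1 (\<phi>2 b) = \<phi>1 (\<phi>2 c) \<or> adjacent N (\<phi>1 (\<phi>2 b)) (\<phi>1 (\<phi>2 c))"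
      if "b \<in> verts L" "c \<in> verts L" "adjacent L b c" for b c
    proof -
      have "\<phi>2 b = \<phi>2 c \<or> adjacent M (\<phi>2 b) (\<phi>2 c)"
        using that D2(1) unfolding graph_morphisms_def by auto
      then show ?thesis
        using \<phi>2 that D1(1) unfolding graph_morphisms_def by auto
    qed
    moreover have "?\<phi> \<in> verts L \<rightarrow>\<^sub>E verts N"
      using D1(2) D2(2) compose_PiE by blast
    ultimately show ?thesis
      unfolding graph_morphisms_def by (auto simp: compose_eq)
  qed
  moreover have "?p b \<in> local_states N (?\<phi> b) \<rightarrow> local_states L b" if "b \<in> verts L" for b
  proof -
    have "p1 (\<phi>2 b) \<in> local_states N (\<phi>1 (\<phi>2 b)) \<rightarrow> local_states M (\<phi>2 b)"
      using p1 \<phi>2[OF that] by blast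
    then show ?thesis using p2 that by (fastforce simp: compose_eq)
  qed
  moreover have "compose (states N) h2 h1 = adjoint_map N L ?\<phi> ?p"
  proof (rule extensionalityI[of _ "states N"])
    fix x assume x: "x \<in> states N"
    then have "h1 x \<in> states M" using D1(3) by auto
    then have "compose (states N) h2 h1 x = (\<lambda>b\<in>verts L. p2 b (h1 x (\<phi>2 b)))"
      using x by (simp add: compose_eq h2 adjoint_map_def)
    also have "\<dots> = (\<lambda>b\<in>verts L. ?p b (x (?\<phi> b)))"
      using x \<phi>2 by (intro restrict_ext) (simp add: h1 adjoint_map_def compose_eq)
    finally show "compose (states N) h2 h1 x = adjoint_map N L ?\<phi> ?p x"
      using x by (simp add: adjoint_map_def)
  qed (auto simp: adjoint_map_def)
  ultimately have "?\<phi> \<in> graph_morphisms L N \<and>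
      (\<exists>p. (\<forall>b\<in>verts L. p b \<in> local_states N (?\<phi> b) \<rightarrow> local_states L b)
        \<and> compose (states N) h2 h1 = adjoint_map N L ?\<phi> p)"
    by (intro conjI exI[of _ ?p] ballI)
  then show ?thesis unfolding morphism_data_def by simp
qed

lemma set_schedule: "\<tau> \<in> schedules N \<Longrightarrow> set \<tau> = verts N"
  unfolding schedules_def by (auto dest: permutations_of_setD)

lemma schedule_in_associated_orders:
  "is_sds F \<Longrightarrow> schedule F \<in> associated_orders F (schedule F)"
  unfolding associated_orders_def is_sds_def by auto

lemma sds_homsD:
  assumes "(\<phi>, h) \<in> sds_homs F G"
  shows "(\<phi>, h) \<in> morphism_data F G"
    and "\<And>\<tau> K. \<lbrakk>\<tau> \<in> associated_orders G (schedule G); K \<in> components G\<rbrakk> \<Longrightarrow>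
      filter (\<lambda>b. b \<in> K) \<tau> = concat (map (\<lambda>a. filter (\<lambda>b. b \<in> K \<and> \<phi> b = a) \<tau>) (schedule F))"
    and "\<And>\<tau>. \<tau> \<in> associated_orders G (schedule G) \<Longrightarrow> \<forall>a\<in>verts F.
      compose (states F) (composite G (loc_fun G) (filter (\<lambda>b. \<phi> b = a) \<tau>)) h
        = compose (states F) h (loc_fun F a)"
  using assms unfolding sds_homs_def by blast+

lemma update_PiE: "is_sds F \<Longrightarrow> update F \<in> states F \<rightarrow>\<^sub>E states F"
  unfolding update_def is_sds_def using composite_PiE set_schedule by blast

text \<open>The theorem of Laubenbacher and Pareigis.\<close>

lemma sds_hom_intertwines_update:
  assumes F: "is_sds F" and G: "is_sds G" and hom: "(\<phi>, h) \<in> sds_homs F G"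
  shows "compose (states F) h (update F) = compose (states F) (update G) h"
proof -
  let ?\<beta> = "schedule G"
  let ?ys = "concat (map (\<lambda>a. filter (\<lambda>b. \<phi> b = a) ?\<beta>) (schedule F))"
  note \<beta> = schedule_in_associated_orders[OF G]
  have f: "loc_fun F \<in> (\<Pi>\<^sub>E a\<in>verts F. local_functions F a)"
    and g: "loc_fun G \<in> (\<Pi>\<^sub>E a\<in>verts G. local_functions G a)"
    and sets: "set (schedule F) = verts F" "set ?\<beta> = verts G"
    using F G set_schedule unfolding is_sds_def by blast+
  have "composite G (loc_fun G) ?\<beta> = composite G (loc_fun G) ?ys"
    using sds_homsD(2)[OF hom \<beta>] sets
    by (intro composite_eq_if_same_orders_on_components[OF g]) (auto simp: filter_concat_fibres)
  then have "compose (states F) (update G) h = compose (states F) (composite G (loc_fun G) ?ys) h"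
    unfolding update_def by simp
  also have "\<dots> = compose (states F) h (update F)"
    unfolding update_def
    using composite_intertwined[OF f g] morphism_dataD(3)[OF sds_homsD(1)[OF hom]]
      sds_homsD(3)[OF hom \<beta>] sets by blast
  finally show ?thesis by simp
qed

lemma filter_eq_distinct:
  "distinct xs \<Longrightarrow> filter (\<lambda>b. b = a) xs = (if a \<in> set xs then [a] else [])"
  by (induction xs) (auto simp: filter_empty_conv)

lemma sds_homs_Ident:
  assumes F: "is_sds F"
  shows "(\<lambda>a\<in>verts F. a, \<lambda>x\<in>states F. x) \<in> sds_homs F F"
proof -
  let ?\<phi> = "\<lambda>a\<in>verts F. a"
  have f: "loc_fun F \<in> (\<Pi>\<^sub>E a\<in>verts F. local_functions F a)"
    and sched: "set (schedule F) = verts F"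
    using F set_schedule unfolding is_sds_def by blast+
  have fibre: "filter (\<lambda>b. ?\<phi> b = a) \<tau> = [a]"
    if "\<tau> \<in> associated_orders F (schedule F)" "a \<in> verts F" for \<tau> a
  proof -
    have \<tau>: "set \<tau> = verts F" "distinct \<tau>"
      using that(1) unfolding associated_orders_def schedules_def
      by (auto dest: permutations_of_setD)
    then have "filter (\<lambda>b. ?\<phi> b = a) \<tau> = filter (\<lambda>b. b = a) \<tau>" by (intro filter_cong) auto
    then show ?thesis using \<tau> that(2) by (simp add: filter_eq_distinct)
  qed
  have "filter (\<lambda>b. b \<in> K) \<tau>
      = concat (map (\<lambda>a. filter (\<lambda>b. b \<in> K \<and> ?\<phi> b = a) \<tau>) (schedule F))"
    if \<tau>: "\<tau> \<in> associated_orders F (schedule F)" and K: "K \<in> components F" for \<tau> K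
  proof -
    have "concat (map (\<lambda>a. filter (\<lambda>b. b \<in> K \<and> ?\<phi> b = a) \<tau>) (schedule F))
        = filter (\<lambda>b. b \<in> K) (concat (map (\<lambda>a. filter (\<lambda>b. ?\<phi> b = a) \<tau>) (schedule F)))"
      by (rule filter_concat_fibres[symmetric])
    also have "map (\<lambda>a. filter (\<lambda>b. ?\<phi> b = a) \<tau>) (schedule F) = map (\<lambda>a. [a]) (schedule F)"
      using fibre[OF \<tau>] sched by (intro map_cong) auto
    also have "concat (map (\<lambda>a. [a]) (schedule F)) = schedule F"
      by (induction "schedule F") simp_all
    finally show ?thesis using \<tau> K unfolding associated_orders_def by simp
  qed
  moreover have "compose (states F) (composite F (loc_fun F) (filter (\<lambda>b. ?\<phi> b = a) \<tau>))
          (\<lambda>x\<in>states F. x) = compose (states F) (\<lambda>x\<in>states F. x) (loc_fun F a)"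
    if "\<tau> \<in> associated_orders F (schedule F)" and a: "a \<in> verts F" for \<tau> a
  proof -
    have "loc_fun F a \<in> states F \<rightarrow>\<^sub>E states F"
      using local_function_PiE PiE_mem[OF f a] a by blast
    then show ?thesis
      unfolding fibre[OF that] composite_singleton[OF f a] by (simp add: compose_restrict_id)
  qed
  ultimately show ?thesis
    using morphism_data_Ident[of F] unfolding sds_homs_def by auto
qed

lemma sds_homs_Comp:
  assumes F: "is_sds F" and G: "is_sds G" and H: "is_sds H"
    and 1: "(\<phi>1, h1) \<in> sds_homs F G" and 2: "(\<phi>2, h2) \<in> sds_homs G H"
  shows "(compose (verts H) \<phi>1 \<phi>2, compose (states F) h2 h1) \<in> sds_homs F H"
proof -
  let ?\<phi> = "compose (verts H) \<phi>1 \<phi>2" and ?\<beta> = "schedule G"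
  note \<beta> = schedule_in_associated_orders[OF G]
  note m1 = morphism_dataD[OF sds_homsD(1)[OF 1]] and m2 = morphism_dataD[OF sds_homsD(1)[OF 2]]
  have g: "loc_fun G \<in> (\<Pi>\<^sub>E b\<in>verts G. local_functions G b)"
    and l: "loc_fun H \<in> (\<Pi>\<^sub>E c\<in>verts H. local_functions H c)"
    and net: "is_network H"
    and sched: "set ?\<beta> = verts G"
    using G H set_schedule unfolding is_sds_def by blast+
  have fibre: "filter (\<lambda>b. b \<in> L \<and> ?\<phi> b = a) \<sigma>
      = concat (map (\<lambda>c. filter (\<lambda>b. b \<in> L \<and> \<phi>2 b = c) \<sigma>) (filter (\<lambda>c. \<phi>1 c = a) ?\<beta>))"
    if \<sigma>: "\<sigma> \<in> associated_orders H (schedule H)" and L: "L \<in> components H" for \<sigma> L a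
  proof -
    have "filter (\<lambda>b. b \<in> L \<and> ?\<phi> b = a) \<sigma> = filter (\<lambda>b. b \<in> L \<and> \<phi>1 (\<phi>2 b) = a) \<sigma>"
      using components_subset_verts[OF L] by (intro filter_cong) (auto simp: compose_eq)
    then show ?thesis
      using fibre_of_composite[where P = "\<lambda>b. b \<in> L", OF sds_homsD(2)[OF 2 \<sigma> L]] by simp
  qed
  have "filter (\<lambda>b. b \<in> L) \<sigma>
      = concat (map (\<lambda>a. filter (\<lambda>b. b \<in> L \<and> ?\<phi> b = a) \<sigma>) (schedule F))"
    if \<sigma>: "\<sigma> \<in> associated_orders H (schedule H)" and L: "L \<in> components H" for \<sigma> L
  proof -
    let ?G = "\<lambda>c. filter (\<lambda>b. b \<in> L \<and> \<phi>2 b = c) \<sigma>"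
    \<comment> \<open>The order condition for the first homomorphism concerns only one component at a time, so
      the schedule of \<open>G\<close> is first restricted to the component which contains the image of \<open>L\<close>.\<close>
    obtain K where K: "K \<in> components G" "\<phi>2 ` L \<subseteq> K"
      using graph_morphism_maps_component[OF net m2(1) L] by blast
    have outside: "?G c = []" if "c \<notin> K" for c
      using that K(2) by (auto simp: filter_empty_conv)
    have "filter (\<lambda>b. b \<in> L) \<sigma> = concat (map ?G ?\<beta>)"
      by (rule sds_homsD(2)[OF 2 \<sigma> L])
    also have "\<dots> = concat (map ?G (filter (\<lambda>c. c \<in> K) ?\<beta>))"
      using concat_map_filter_irrelevant[of K ?G "\<lambda>_. True" ?\<beta>, OF outside] by simp
    also have "filter (\<lambda>c. c \<in> K) ?\<beta>
        = concat (map (\<lambda>a. filter (\<lambda>c. c \<in> K \<and> \<phi>1 c = a) ?\<beta>) (schedule F))"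
      by (rule sds_homsD(2)[OF 1 \<beta> K(1)])
    also have "concat (map ?G \<dots>)
        = concat (map (\<lambda>a. concat (map ?G (filter (\<lambda>c. c \<in> K \<and> \<phi>1 c = a) ?\<beta>))) (schedule F))"
      by (rule concat_map_concat_map)
    also have "\<dots> = concat (map (\<lambda>a. concat (map ?G (filter (\<lambda>c. \<phi>1 c = a) ?\<beta>))) (schedule F))"
      using concat_map_filter_irrelevant[of K ?G, OF outside] by simp
    finally show ?thesis using fibre[OF \<sigma> L] by simp
  qed
  moreover have "compose (states F) (composite H (loc_fun H) (filter (\<lambda>b. ?\<phi> b = a) \<sigma>))
        (compose (states F) h2 h1) = compose (states F) (compose (states F) h2 h1) (loc_fun F a)"
    if \<sigma>: "\<sigma> \<in> associated_orders H (schedule H)" and a: "a \<in> verts F" for \<sigma> a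
  proof -
    let ?as = "filter (\<lambda>c. \<phi>1 c = a) ?\<beta>"
    let ?ys = "concat (map (\<lambda>c. filter (\<lambda>b. \<phi>2 b = c) \<sigma>) ?as)"
    let ?fib = "composite G (loc_fun G) ?as"
    have sub: "set \<sigma> \<subseteq> verts H" using \<sigma> set_schedule unfolding associated_orders_def by blast
    have h1: "h1 \<in> states F \<rightarrow> states G" using m1(3) by auto
    have f: "loc_fun F a \<in> states F \<rightarrow> states F"
      using F a local_function_PiE[of "loc_fun F a" F a] unfolding is_sds_def
      by (auto simp: PiE_iff)
    \<comment> \<open>The two lists may differ, but only in the relative position of different components.\<close>
    have "composite H (loc_fun H) (filter (\<lambda>b. ?\<phi> b = a) \<sigma>) = composite H (loc_fun H) ?ys"
      using sub fibre[OF \<sigma>]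
      by (intro composite_eq_if_same_orders_on_components[OF l])
        (auto simp: filter_concat_fibres conj_commute)
    then have "compose (states F) (composite H (loc_fun H) (filter (\<lambda>b. ?\<phi> b = a) \<sigma>))
        (compose (states F) h2 h1)
      = compose (states F) (compose (states G) (composite H (loc_fun H) ?ys) h2) h1"
      using compose_assoc[OF h1] by metis
    also have "\<dots> = compose (states F) (compose (states G) h2 ?fib) h1"
      using composite_intertwined[OF g l m2(3) sub sds_homsD(3)[OF 2 \<sigma>], of ?as] sched
      by auto
    also have "\<dots> = compose (states F) h2 (compose (states F) ?fib h1)"
      using compose_assoc[OF h1] by metis
    also have "\<dots> = compose (states F) h2 (compose (states F) h1 (loc_fun F a))"
      using sds_homsD(3)[OF 1 \<beta>] a by simp
    also have "\<dots> = compose (states F) (compose (states F) h2 h1) (loc_fun F a)"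
      using compose_assoc[OF f] by metis
    finally show ?thesis .
  qed
  ultimately show ?thesis
    using morphism_data_Comp[OF sds_homsD(1)[OF 1] sds_homsD(1)[OF 2]]
    unfolding sds_homs_def by blast
qed

text \<open>The category laws for the underlying maps, which are common to SDS and PSN.\<close>

lemma morphism_data_category_laws:
  assumes "(\<phi>, h) \<in> morphism_data N M"
  shows "compose (verts M) (\<lambda>a\<in>verts N. a) \<phi> = \<phi>" "compose (states N) h (\<lambda>x\<in>states N. x) = h"
    and "compose (verts M) \<phi> (\<lambda>b\<in>verts M. b) = \<phi>" "compose (states N) (\<lambda>x\<in>states M. x) h = h"
  using morphism_dataD[OF assms] by (simp_all add: compose_restrict_id)

lemma morphism_data_assoc:
  assumes 1: "(\<phi>1, h1) \<in> morphism_data N M" and 3: "(\<phi>3, h3) \<in> morphism_data L L'"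
  shows "compose (verts L') (compose (verts L) \<phi>1 \<phi>2) \<phi>3
      = compose (verts L') \<phi>1 (compose (verts L') \<phi>2 \<phi>3)"
    and "compose (states N) h3 (compose (states N) h2 h1)
      = compose (states N) (compose (states M) h3 h2) h1"
proof -
  have "h1 \<in> states N \<rightarrow> states M" "\<phi>3 \<in> verts L' \<rightarrow> verts L"
    using morphism_dataD[OF 1] morphism_dataD[OF 3] by auto
  then show "compose (verts L') (compose (verts L) \<phi>1 \<phi>2) \<phi>3
      = compose (verts L') \<phi>1 (compose (verts L') \<phi>2 \<phi>3)"
    and "compose (states N) h3 (compose (states N) h2 h1)
      = compose (states N) (compose (states M) h3 h2) h1"
    by (metis compose_assoc)+
qed

lemma category_SDS: "category SDS"
proof (rule category.intro)
  fix A B :: "'a sds" and f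
  assume "A \<in> Ob SDS" "B \<in> Ob SDS" "f \<in> Hom SDS A B"
  then obtain \<phi> h where "f = (\<phi>, h)" "(\<phi>, h) \<in> morphism_data A B"
    using sds_homsD(1) by (cases f) (auto simp: SDS_def)
  then show "Comp SDS A A B f (Ident SDS A) = f" "Comp SDS A B B (Ident SDS B) f = f"
    using morphism_data_category_laws by (auto simp: SDS_def)
next
  fix A B D E :: "'a sds" and f g h :: "(nat \<Rightarrow> nat) \<times> 'a gmap"
  assume fh: "f \<in> Hom SDS A B" "h \<in> Hom SDS D E"
  obtain \<phi>1 h1 \<phi>2 h2 \<phi>3 h3 where eq: "f = (\<phi>1, h1)" "g = (\<phi>2, h2)" "h = (\<phi>3, h3)"
    by (cases f; cases g; cases h)
  have "(\<phi>1, h1) \<in> morphism_data A B" "(\<phi>3, h3) \<in> morphism_data D E"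
    using fh sds_homsD(1) by (auto simp: SDS_def eq)
  note assoc = morphism_data_assoc[OF this]
  show "Comp SDS A D E h (Comp SDS A B D g f) = Comp SDS A B E (Comp SDS B D E h g) f"
    using assoc by (simp add: SDS_def eq)
qed (auto simp: SDS_def sds_homs_Ident sds_homs_Comp)


section \<open>Probabilistic sequential networks\<close>

lemma sds_of_simps [simp]:
  "verts (sds_of D f) = verts D" "states (sds_of D f) = states D"
  "loc_fun (sds_of D f) = fst (choice D f)" "schedule (sds_of D f) = snd (choice D f)"
  "local_functions (sds_of D f) = local_functions D" "schedules (sds_of D f) = schedules D"
  "is_network (sds_of D f) = is_network D"
proof -
  show v: "verts (sds_of D f) = verts D"
    by (simp add: verts_def sds_of_def)
  then show s: "states (sds_of D f) = states D"
    by (simp add: states_def) (simp add: sds_of_def)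
  show "loc_fun (sds_of D f) = fst (choice D f)" "schedule (sds_of D f) = snd (choice D f)"
    by (simp_all add: sds_of_def)
  have "adjacent (sds_of D f) = adjacent D"
    by (intro ext) (simp add: adjacent_def sds_of_def)
  then show "local_functions (sds_of D f) = local_functions D"
    using v s by (intro ext) (simp add: local_functions_def, simp add: sds_of_def)
  show "schedules (sds_of D f) = schedules D" "is_network (sds_of D f) = is_network D"
    using v by (simp_all add: schedules_def is_network_def) (simp add: sds_of_def)
qed

lemma is_sds_sds_of:
  assumes D: "is_psn D" and f: "f \<in> selected D"
  shows "is_sds (sds_of D f)"
proof -
  have "choice D f \<in> (\<Pi>\<^sub>E a\<in>verts D. loc_funs D a) \<times> set (schedule_family D)"
    using D f unfolding is_psn_def by (blast dest: PiE_mem)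
  moreover have "\<forall>a\<in>verts D. loc_funs D a \<subseteq> local_functions D a" "is_network D"
      "set (schedule_family D) \<subseteq> schedules D"
    using D unfolding is_psn_def by blast+
  ultimately show ?thesis
    unfolding is_sds_def by (auto simp: mem_Times_iff PiE_iff)
qed

lemma selected_PiE:
  assumes "is_psn D" "f \<in> selected D"
  shows "f \<in> states D \<rightarrow>\<^sub>E states D"
proof -
  have "update (sds_of D f) = f" using assms unfolding is_psn_def by blast
  then show ?thesis using update_PiE[OF is_sds_sds_of[OF assms]] by simp
qed

lemma psn_homs_Ident:
  assumes D: "is_psn D"
  shows "(\<lambda>a\<in>verts D. a, \<lambda>x\<in>states D. x, \<lambda>f\<in>selected D. f) \<in> psn_homs D D"
  using morphism_data_Ident[of D] sds_homs_Ident[OF is_sds_sds_of[OF D]]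
    compose_restrict_id[OF selected_PiE[OF D]]
  unfolding psn_homs_def by auto

lemma psn_homsD:
  assumes "(\<phi>, h, \<mu>) \<in> psn_homs D1 D2"
  shows "(\<phi>, h) \<in> morphism_data D1 D2" "\<mu> \<in> selected D1 \<rightarrow>\<^sub>E selected D2"
    and "\<And>f. f \<in> selected D1 \<Longrightarrow> (\<phi>, h) \<in> sds_homs (sds_of D1 f) (sds_of D2 (\<mu> f))"
  using assms unfolding psn_homs_def by blast+

text \<open>The identity \<open>h \<circ> f = \<mu>(f) \<circ> h\<close> for a composite need not be checked separately: it holds for
  every homomorphism between the underlying SDS.\<close>

lemma psn_homs_Comp:
  assumes D: "is_psn D1" "is_psn D2" "is_psn D3"
    and 1: "(\<phi>1, h1, \<mu>1) \<in> psn_homs D1 D2" and 2: "(\<phi>2, h2, \<mu>2) \<in> psn_homs D2 D3"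
  shows "(compose (verts D3) \<phi>1 \<phi>2, compose (states D1) h2 h1, compose (selected D1) \<mu>2 \<mu>1)
    \<in> psn_homs D1 D3"
proof -
  let ?\<phi> = "compose (verts D3) \<phi>1 \<phi>2" and ?h = "compose (states D1) h2 h1"
  note H1 = psn_homsD[OF 1] and H2 = psn_homsD[OF 2]
  have \<mu>: "compose (selected D1) \<mu>2 \<mu>1 \<in> selected D1 \<rightarrow>\<^sub>E selected D3"
    using H1(2) H2(2) compose_PiE by blast
  have "(?\<phi>, ?h) \<in> sds_homs (sds_of D1 f) (sds_of D3 (\<mu>2 (\<mu>1 f)))"
    and "compose (states D1) ?h f = compose (states D1) (\<mu>2 (\<mu>1 f)) ?h"
    if f: "f \<in> selected D1" for f
  proof -
    have sel: "\<mu>1 f \<in> selected D2" "\<mu>2 (\<mu>1 f) \<in> selected D3"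
      using f H1(2) H2(2) by auto
    show hom: "(?\<phi>, ?h) \<in> sds_homs (sds_of D1 f) (sds_of D3 (\<mu>2 (\<mu>1 f)))"
      using sds_homs_Comp[OF is_sds_sds_of[OF D(1) f] is_sds_sds_of[OF D(2) sel(1)]
        is_sds_sds_of[OF D(3) sel(2)] H1(3)[OF f] H2(3)[OF sel(1)]] by simp
    have "update (sds_of D1 f) = f" "update (sds_of D3 (\<mu>2 (\<mu>1 f))) = \<mu>2 (\<mu>1 f)"
      using D f sel unfolding is_psn_def by blast+
    then show "compose (states D1) ?h f = compose (states D1) (\<mu>2 (\<mu>1 f)) ?h"
      using sds_hom_intertwines_update[OF is_sds_sds_of[OF D(1) f]
        is_sds_sds_of[OF D(3) sel(2)] hom] by simp
  qed
  then show ?thesis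
    using \<mu> morphism_data_Comp[OF H1(1) H2(1)] unfolding psn_homs_def
    by (auto simp: compose_eq)
qed

lemma category_PSN: "category PSN"
proof (rule category.intro)
  fix A B :: "'a psn" and f
  assume Hom: "f \<in> Hom PSN A B"
  obtain \<phi> h \<mu> where f: "f = (\<phi>, h, \<mu>)" by (rule prod_cases3)
  have "(\<phi>, h, \<mu>) \<in> psn_homs A B" using Hom unfolding f by (simp add: PSN_def)
  note laws = morphism_data_category_laws[OF psn_homsD(1)[OF this]]
    compose_restrict_id[OF psn_homsD(2)[OF this]]
  show "Comp PSN A A B f (Ident PSN A) = f" "Comp PSN A B B (Ident PSN B) f = f"
    using laws by (simp_all add: PSN_def f)
next
  fix A B D E :: "'a psn" and f g h :: "'a psn_mor"
  assume "f \<in> Hom PSN A B" "h \<in> Hom PSN D E"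
  moreover obtain \<phi>1 h1 \<mu>1 \<phi>2 h2 \<mu>2 \<phi>3 h3 \<mu>3
    where eq: "f = (\<phi>1, h1, \<mu>1)" "g = (\<phi>2, h2, \<mu>2)" "h = (\<phi>3, h3, \<mu>3)"
    by (metis prod_cases3)
  ultimately have fh: "(\<phi>1, h1, \<mu>1) \<in> psn_homs A B" "(\<phi>3, h3, \<mu>3) \<in> psn_homs D E"
    by (auto simp: PSN_def)
  have "\<mu>1 \<in> selected A \<rightarrow> selected B" using psn_homsD(2)[OF fh(1)] by auto
  from compose_assoc[OF this]
  have "compose (selected A) \<mu>3 (compose (selected A) \<mu>2 \<mu>1)
      = compose (selected A) (compose (selected B) \<mu>3 \<mu>2) \<mu>1" .
  then show "Comp PSN A D E h (Comp PSN A B D g f) = Comp PSN A B E (Comp PSN B D E h g) f"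
    using morphism_data_assoc[OF psn_homsD(1)[OF fh(1)] psn_homsD(1)[OF fh(2)]]
    by (simp add: PSN_def eq)
qed (auto simp: PSN_def psn_homs_Ident psn_homs_Comp)

lemma category_full_subcategory_on:
  assumes "category C"
  shows "category (full_subcategory_on C P)"
proof -
  interpret category C by fact
  show ?thesis
    unfolding full_subcategory_on_def
    by (rule category.intro)
      (auto intro: Ident_in_Hom Comp_in_Hom Comp_Ident_right Comp_Ident_left Comp_assoc)
qed


section \<open>Sequential dynamical systems as deterministic networks\<close>

lemma psn_of_sds_simps [simp]:
  "verts (psn_of_sds F) = verts F" "states (psn_of_sds F) = states F"
  "local_functions (psn_of_sds F) = local_functions F" "schedules (psn_of_sds F) = schedules F"
  "is_network (psn_of_sds F) = is_network F" "selected (psn_of_sds F) = {update F}"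
proof -
  show v: "verts (psn_of_sds F) = verts F"
    by (simp add: verts_def psn_of_sds_def)
  then show s: "states (psn_of_sds F) = states F"
    by (simp add: states_def) (simp add: psn_of_sds_def)
  have "adjacent (psn_of_sds F) = adjacent F"
    by (intro ext) (simp add: adjacent_def psn_of_sds_def)
  then show "local_functions (psn_of_sds F) = local_functions F"
    using v s by (intro ext) (simp add: local_functions_def, simp add: psn_of_sds_def)
  show "schedules (psn_of_sds F) = schedules F" "is_network (psn_of_sds F) = is_network F"
    using v by (simp_all add: schedules_def is_network_def) (simp add: psn_of_sds_def)
  show "selected (psn_of_sds F) = {update F}"
    by (simp add: psn_of_sds_def)
qed

lemma sds_of_psn_of_sds [simp]: "sds_of (psn_of_sds F) (update F) = F"
  by (simp add: sds_of_def psn_of_sds_def)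

lemma psn_of_sds_deterministic:
  assumes F: "is_sds F"
  shows "is_psn (psn_of_sds F)" "psn_of_sds F \<in> deterministic_psns"
proof -
  show psn: "is_psn (psn_of_sds F)"
    using F unfolding is_psn_def is_sds_def
    by (simp add: PiE_iff) (auto simp: psn_of_sds_def PiE_iff extensional_def)
  then show "psn_of_sds F \<in> deterministic_psns"
    unfolding deterministic_psns_def by simp (simp add: psn_of_sds_def)
qed

lemma psn_of_sds_inj:
  assumes eq: "psn_of_sds F = psn_of_sds G"
  shows "F = G"
proof -
  have "update F = update G"
    using psn_of_sds_simps(6)[of F] psn_of_sds_simps(6)[of G] eq by simp
  then show ?thesis using sds_of_psn_of_sds eq by metis
qed

lemma deterministic_psn_is_psn_of_sds:
  assumes "D \<in> deterministic_psns"
  shows "\<exists>F. is_sds F \<and> psn_of_sds F = D"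
proof -
  have D: "is_psn D" and one: "\<forall>a\<in>verts D. card (loc_funs D a) = 1"
    and "length (schedule_family D) = 1"
    using assms unfolding deterministic_psns_def by auto
  then obtain \<alpha> where \<alpha>: "schedule_family D = [\<alpha>]"
    by (auto simp: length_Suc_conv)
  define f where "f = (\<lambda>a\<in>verts D. THE g. g \<in> loc_funs D a)"
  have loc_funs: "loc_funs D a = {f a}" if "a \<in> verts D" for a
    using one that card_1_singletonE[of "loc_funs D a"] unfolding f_def by force
  define F :: "'a sds" where "F = \<lparr>nverts = nverts D, edges = edges D,
    local_states = local_states D, loc_fun = f, schedule = \<alpha>\<rparr>"
  have choice: "choice D u = (f, \<alpha>)" if "u \<in> selected D" for u
  proof -
    have "choice D u \<in> (\<Pi>\<^sub>E a\<in>verts D. loc_funs D a) \<times> set (schedule_family D)"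
      using D that unfolding is_psn_def by (blast dest: PiE_mem)
    moreover have "g = f" if "g \<in> (\<Pi>\<^sub>E a\<in>verts D. loc_funs D a)" for g
    proof (rule extensionalityI[of _ "verts D"])
      show "g a = f a" if "a \<in> verts D" for a
        using PiE_mem[OF \<open>g \<in> _\<close> that] loc_funs[OF that] by simp
    qed (use that in \<open>auto simp: f_def PiE_iff\<close>)
    ultimately show ?thesis using \<alpha> by (auto simp: mem_Times_iff prod_eq_iff)
  qed
  have sds_of: "sds_of D u = F" if "u \<in> selected D" for u
    using choice[OF that] by (simp add: sds_of_def F_def)
  \<comment> \<open>The probabilities of an empty set of update functions would add up to 0.\<close>
  have "selected D \<noteq> {}"
    using D unfolding is_psn_def by auto
  moreover have "u = update F" if "u \<in> selected D" for u
    using D sds_of that unfolding is_psn_def by metis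
  ultimately have sel: "selected D = {update F}" by blast
  have "is_sds F"
    using is_sds_sds_of[OF D] sds_of sel by force
  moreover have "psn_of_sds F = D"
  proof -
    have verts: "verts F = verts D" by (simp add: F_def verts_def)
    have "loc_funs D = (\<lambda>a\<in>verts D. {f a})"
      using D loc_funs unfolding is_psn_def by (auto intro!: extensionalityI[of _ "verts D"])
    moreover have "choice D = (\<lambda>u\<in>{update F}. (f, \<alpha>))"
      using D choice sel unfolding is_psn_def
      by (auto intro!: extensionalityI[of _ "{update F}"] simp: PiE_iff)
    moreover have "prob D = (\<lambda>u\<in>{update F}. 1)"
      using D sel unfolding is_psn_def
      by (auto intro!: extensionalityI[of _ "{update F}"] simp: PiE_iff)
    ultimately show ?thesis
      using \<alpha> sel verts by (simp add: psn_of_sds_def) (simp add: F_def)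
  qed
  ultimately show ?thesis by blast
qed

lemma morphism_data_psn_of_sds [simp]:
  "morphism_data (psn_of_sds F) (psn_of_sds G) = morphism_data F G"
proof -
  have "adjacent (psn_of_sds F) = adjacent F" "local_states (psn_of_sds F) = local_states F"
    for F :: "'a sds"
    by (auto simp: adjacent_def psn_of_sds_def fun_eq_iff)
  then show ?thesis
    unfolding morphism_data_def graph_morphisms_def adjoint_map_def by simp
qed

lemma psn_homs_psn_of_sds:
  assumes F: "is_sds F" and G: "is_sds G"
  shows "psn_homs (psn_of_sds F) (psn_of_sds G) = psn_hom_of_sds_hom F G ` sds_homs F G"
proof -
  have "(\<phi>, h, \<mu>) \<in> psn_homs (psn_of_sds F) (psn_of_sds G)
      \<longleftrightarrow> (\<phi>, h) \<in> sds_homs F G \<and> \<mu> = (\<lambda>f\<in>{update F}. update G)" for \<phi> h \<mu>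
  proof -
    have "\<mu> \<in> {update F} \<rightarrow>\<^sub>E {update G} \<longleftrightarrow> \<mu> = (\<lambda>f\<in>{update F}. update G)"
      by (auto simp: PiE_iff extensional_def fun_eq_iff)
    then show ?thesis
      using sds_hom_intertwines_update[OF F G] sds_homsD(1) unfolding psn_homs_def by auto
  qed
  then show ?thesis
    by (force simp: psn_hom_of_sds_hom_def)
qed

lemma category_isomorphism_psn_of_sds:
  "category_isomorphism SDS (full_subcategory_on PSN deterministic_psns)
    psn_of_sds psn_hom_of_sds_hom"
proof -
  let ?D = "full_subcategory_on PSN deterministic_psns"
  interpret S: category SDS by (rule category_SDS)
  interpret D: category ?D by (rule category_full_subcategory_on[OF category_PSN])
  have Ob: "Ob ?D = deterministic_psns"
    by (auto simp: full_subcategory_on_def PSN_def deterministic_psns_def)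
  have Hom: "Hom ?D = psn_homs"
    by (simp add: full_subcategory_on_def PSN_def)
  show ?thesis
  proof
    fix A :: "'a sds"
    assume "A \<in> Ob SDS"
    then show "psn_of_sds A \<in> Ob ?D"
      unfolding Ob using psn_of_sds_deterministic(2) by (auto simp: SDS_def)
  next
    fix A B :: "'a sds" and f
    assume "A \<in> Ob SDS" "B \<in> Ob SDS" "f \<in> Hom SDS A B"
    then show "psn_hom_of_sds_hom A B f \<in> Hom ?D (psn_of_sds A) (psn_of_sds B)"
      unfolding Hom using psn_homs_psn_of_sds by (auto simp: SDS_def)
  next
    fix A :: "'a sds"
    show "psn_hom_of_sds_hom A A (Ident SDS A) = Ident ?D (psn_of_sds A)"
      by (auto simp: psn_hom_of_sds_hom_def SDS_def PSN_def full_subcategory_on_def fun_eq_iff)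
  next
    fix A B E :: "'a sds" and f g :: "(nat \<Rightarrow> nat) \<times> 'a gmap"
    show "psn_hom_of_sds_hom A E (Comp SDS A B E g f)
        = Comp ?D (psn_of_sds A) (psn_of_sds B) (psn_of_sds E)
            (psn_hom_of_sds_hom B E g) (psn_hom_of_sds_hom A B f)"
      by (cases f; cases g)
        (auto simp: psn_hom_of_sds_hom_def SDS_def PSN_def full_subcategory_on_def
          compose_def fun_eq_iff)
  next
    show "bij_betw psn_of_sds (Ob SDS) (Ob ?D)"
      unfolding Ob bij_betw_def inj_on_def
      using psn_of_sds_inj psn_of_sds_deterministic(2) deterministic_psn_is_psn_of_sds
      by (force simp: SDS_def)
  next
    fix A B :: "'a sds"
    assume "A \<in> Ob SDS" "B \<in> Ob SDS"
    then show "bij_betw (psn_hom_of_sds_hom A B) (Hom SDS A B)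
        (Hom ?D (psn_of_sds A) (psn_of_sds B))"
      unfolding Hom bij_betw_def
      using psn_homs_psn_of_sds by (auto simp: SDS_def inj_on_def psn_hom_of_sds_hom_def)
  qed
qed

theorem theorem6p3:
  shows "category (SDS :: ('s sds, (nat \<Rightarrow> nat) \<times> 's gmap) precategory)
    \<and> category (PSN :: ('s psn, 's psn_mor) precategory)
    \<and> category_isomorphism (SDS :: ('s sds, (nat \<Rightarrow> nat) \<times> 's gmap) precategory)
        (full_subcategory_on PSN deterministic_psns) psn_of_sds psn_hom_of_sds_hom"
  using category_SDS category_PSN category_isomorphism_psn_of_sds by blast

end
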